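(* Let $(X,T,\mu)$ be an ergodic conservative dynamical system, where $\mu$ is a $T$-invariant and not necessarily finite measure on $X$, and let $\mathcal{Z}$ be a finite measurable partition of $X$. Then $$\bar\alpha(x):=\inf\left\{\alpha\ :\ \liminf_{n\to\infty}\frac{\tau(Z_n(x))}{n^\alpha}=0\right\}$$ is $\mu$-a.e. equal to a constant $\bar\alpha$. If moreover $0\le\overline{K}(x,T,\mathcal{Z})<\infty$ (for $\mu$-a.e. $x$), then for $\mu$-a.e. $x\in X$ we have $$\liminf_{n\to\infty}\frac{AIC(x,n)}{n^\beta}=0\qquad\text{for all }\beta>\bar\alpha .$$
   Context: $Z_n(x)$ is the element of the partition $\bigvee_{k=0}^{n-1}T^{-k}\mathcal{Z}$ containing $x$. For $A\subset X$, the Poincaré recurrence time is $\tau(A)=\min\{k>0: T^kA\cap A\neq\emptyset\}$. Algorithmic information content: let $A_1,A_2,\dots$ be a computable enumeration of the Turing machines and $e_n$ the $n$-th binary string in lexicographical order $0,1,00,01,\dots$. Fix a universal Turing machine $U$, i.e. one with $U(\hat e_n p)=A_n(p)$ for all $n$ and all finite binary strings $p$, where for a word $q$ of length $m$, $\hat q=q(0)q(0)q(1)q(1)\cdots q(m-1)q(m-1)01$. For a finite string $s$ over a finite alphabet, $AIC_U(s)=\min\{\ell(p):U(p)=s\}$ over finite binary strings $p$, with $\ell(p)$ the length of $p$ (and $\infty$ if there is no such $p$). Writing $\mathcal{Z}=\{I_0,\dots,I_{m}\}$ and letting $\omega=\omega_0\omega_1\cdots$ be the symbolic orbit of $x$ ($T^jx\in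 I_{\omega_j}$), put $AIC(x,n)=AIC_U(\omega_0\cdots\omega_{n-1})$ and $\overline{K}(x,T,\mathcal{Z})=\limsup_{n\to\infty}AIC(x,n)/n$. *)

theory Defs
  imports "HOL-Analysis.Analysis" "HOL-Library.Nat_Bijection" "HOL-Library.Disjoint_Sets"
begin

section \<open>Dynamics\<close>

definition invariant_measure :: "'a measure \<Rightarrow> ('a \<Rightarrow> 'a) \<Rightarrow> bool" where
  "invariant_measure M T \<longleftrightarrow>
     T \<in> measurable M M \<and> (\<forall>A\<in>sets M. emeasure M (T -` A \<inter> space M) = emeasure M A)"

definition ergodic :: "'a measure \<Rightarrow> ('a \<Rightarrow> 'a) \<Rightarrow> bool" where
  "ergodic M T \<longleftrightarrow>
     (\<forall>A\<in>sets M. T -` A \<inter> space M = A \<longrightarrow> emeasure M A = 0 \<or> emeasure M (space M - A) = 0)"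

definition wandering_set :: "'a measure \<Rightarrow> ('a \<Rightarrow> 'a) \<Rightarrow> 'a set \<Rightarrow> bool" where
  "wandering_set M T W \<longleftrightarrow>
     W \<in> sets M \<and> disjoint_family (\<lambda>n. (T ^^ n) -` W \<inter> space M)"

definition conservative :: "'a measure \<Rightarrow> ('a \<Rightarrow> 'a) \<Rightarrow> bool" where
  "conservative M T \<longleftrightarrow> (\<forall>W. wandering_set M T W \<longrightarrow> emeasure M W = 0)"

definition finite_measurable_partition :: "'a measure \<Rightarrow> 'a set set \<Rightarrow> bool" where
  "finite_measurable_partition M Z \<longleftrightarrow> finite Z \<and> Z \<subseteq> sets M \<and> partition_on (space M) Z"

text \<open>The join of the preimages of the partition \<open>Z\<close> under the iterates \<open>T ^^ k\<close>, \<open>k < n\<close>.\<close>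

definition dyn_refinement :: "'a measure \<Rightarrow> ('a \<Rightarrow> 'a) \<Rightarrow> 'a set set \<Rightarrow> nat \<Rightarrow> 'a set set" where
  "dyn_refinement M T Z n =
     {space M \<inter> (\<Inter>k<n. (T ^^ k) -` C k) | C. \<forall>k<n. C k \<in> Z} - {{}}"

definition cyl :: "'a measure \<Rightarrow> ('a \<Rightarrow> 'a) \<Rightarrow> 'a set set \<Rightarrow> nat \<Rightarrow> 'a \<Rightarrow> 'a set" where
  "cyl M T Z n x = (THE A. A \<in> dyn_refinement M T Z n \<and> x \<in> A)"

text \<open>If \<open>A\<close> never returns, this is \<open>\<infinity>\<close>; otherwise the infimum is attained.\<close>

definition recurrence_time :: "('a \<Rightarrow> 'a) \<Rightarrow> 'a set \<Rightarrow> enat" where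
  "recurrence_time T A = (INF k\<in>{k. 0 < k \<and> (T ^^ k) ` A \<inter> A \<noteq> {}}. enat k)"

definition alpha_bar :: "'a measure \<Rightarrow> ('a \<Rightarrow> 'a) \<Rightarrow> 'a set set \<Rightarrow> 'a \<Rightarrow> ereal" where
  "alpha_bar M T Z x =
     Inf {ereal \<alpha> | \<alpha>.
       liminf (\<lambda>n. ereal_of_enat (recurrence_time T (cyl M T Z n x)) / ereal (real n powr \<alpha>)) = 0}"

section \<open>Turing machines\<close>

text \<open>
  Single-tape deterministic machines with a two-way infinite tape.  States and tape symbols
  are natural numbers, but each program is a finite list and hence uses only finitely many.
  Symbol \<open>0\<close> is the blank and symbol \<open>Suc i\<close> is the letter \<open>i\<close>.  An entry
  \<open>((q, a), (q', b, d))\<close> means: in state \<open>q\<close> scanning \<open>a\<close>, write \<open>b\<close>, move in direction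
  \<open>d\<close> and enter state \<open>q'\<close>.  If several entries have the same key, the first one counts, so
  every list is a deterministic machine.  A machine halts when no entry applies.
\<close>

datatype dir = MoveL | Stay | MoveR

type_synonym tm = "((nat \<times> nat) \<times> (nat \<times> nat \<times> dir)) list"

text \<open>State, tape contents, head position.\<close>
type_synonym tm_config = "nat \<times> (int \<Rightarrow> nat) \<times> int"

fun shift :: "dir \<Rightarrow> int" where
  "shift MoveL = -1"
| "shift Stay = 0"
| "shift MoveR = 1"

definition tm_step :: "tm \<Rightarrow> tm_config \<Rightarrow> tm_config option" where
  "tm_step P = (\<lambda>(q, t, h).
     case map_of P (q, t h) of
       None \<Rightarrow> None
     | Some (q', b, d) \<Rightarrow> Some (q', t(h := b), h + shift d))"

text \<open>The final configuration; \<open>None\<close> if the machine does not halt.\<close>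

partial_function (option) tm_run :: "tm \<Rightarrow> tm_config \<Rightarrow> tm_config option" where
  "tm_run P c = (case tm_step P c of None \<Rightarrow> Some c | Some c' \<Rightarrow> tm_run P c')"

text \<open>The input is written on cells \<open>0, 1, \<dots>\<close> of a blank tape, with \<open>False\<close> and \<open>True\<close>
  as the letters 0 and 1; the head starts on cell \<open>0\<close> in state \<open>0\<close>.\<close>

definition tm_init :: "bool list \<Rightarrow> tm_config" where
  "tm_init p =
     (0, \<lambda>j. if 0 \<le> j \<and> j < int (length p) then Suc (of_bool (p ! nat j)) else 0, 0)"

text \<open>The output over the alphabet \<open>{0..<k}\<close> is the maximal word of letters of this alphabet
  starting at the head; any other symbol ends it.  Only finitely many cells of a reachable
  configuration are not blank, so the minimum exists.\<close>

definition tm_output :: "nat \<Rightarrow> tm_config \<Rightarrow> nat list" where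
  "tm_output k = (\<lambda>(q, t, h).
     map (\<lambda>j. t (h + int j) - 1) [0..<LEAST j. t (h + int j) \<notin> {1..k}])"

text \<open>The partial function from binary strings to words over \<open>{0..<k}\<close> computed by a machine.\<close>

definition tm_eval :: "nat \<Rightarrow> tm \<Rightarrow> bool list \<Rightarrow> nat list option" where
  "tm_eval k P p = map_option (tm_output k) (tm_run P (tm_init p))"

section \<open>Algorithmic information content\<close>

text \<open>For \<open>n \<ge> 1\<close> this is the \<open>n\<close>-th string in the list 0, 1, 00, 01, 10, 11, 000, \<dots>
  (bijective base-2 numeration).\<close>

fun bin_string :: "nat \<Rightarrow> bool list" where
  "bin_string 0 = []"
| "bin_string (Suc n) = bin_string (n div 2) @ [odd n]"

lemma bin_string_examples:
  "map bin_string [1, 2, 3, 4, 5, 6, 7] =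
     [[False], [True], [False, False], [False, True], [True, False], [True, True],
      [False, False, False]]"
  by code_simp

definition hat :: "bool list \<Rightarrow> bool list" where
  "hat q = concat (map (\<lambda>b. [b, b]) q) @ [False, True]"

fun dir_code :: "dir \<Rightarrow> nat" where
  "dir_code MoveL = 0"
| "dir_code Stay = 1"
| "dir_code MoveR = 2"

definition tm_code :: "tm \<Rightarrow> nat" where
  "tm_code P =
     list_encode (map (\<lambda>((q, a), (q', b, d)). list_encode [q, a, q', b, dir_code d]) P)"

text \<open>Every machine occurs among \<open>A 1, A 2, \<dots>\<close>, and some machine computes the (binary string
  of the) code of \<open>A n\<close> from the \<open>n\<close>-th binary string.  The value \<open>A 0\<close> is irrelevant.\<close>

definition computable_enumeration :: "(nat \<Rightarrow> tm) \<Rightarrow> bool" where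
  "computable_enumeration A \<longleftrightarrow>
     (\<forall>P. \<exists>n\<ge>1. A n = P) \<and>
     (\<exists>C. \<forall>n\<ge>1. tm_eval 2 C (bin_string n) =
                   Some (map of_bool (bin_string (Suc (tm_code (A n))))))"

definition universal_tm :: "nat \<Rightarrow> (nat \<Rightarrow> tm) \<Rightarrow> tm \<Rightarrow> bool" where
  "universal_tm k A U \<longleftrightarrow>
     (\<forall>n\<ge>1. \<forall>p. tm_eval k U (hat (bin_string n) @ p) = tm_eval k (A n) p)"

definition AIC :: "nat \<Rightarrow> tm \<Rightarrow> nat list \<Rightarrow> enat" where
  "AIC k U s = (INF p\<in>{p. tm_eval k U p = Some s}. enat (length p))"

text \<open>The partition is \<open>{I 0, \<dots>, I m}\<close>; the symbols are \<open>0, \<dots>, m\<close>.\<close>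

definition symbol :: "('a \<Rightarrow> 'a) \<Rightarrow> (nat \<Rightarrow> 'a set) \<Rightarrow> nat \<Rightarrow> 'a \<Rightarrow> nat \<Rightarrow> nat" where
  "symbol T I m x j = (THE i. i \<le> m \<and> (T ^^ j) x \<in> I i)"

definition orbit_AIC ::
  "tm \<Rightarrow> ('a \<Rightarrow> 'a) \<Rightarrow> (nat \<Rightarrow> 'a set) \<Rightarrow> nat \<Rightarrow> 'a \<Rightarrow> nat \<Rightarrow> enat" where
  "orbit_AIC U T I m x n = AIC (Suc m) U (map (symbol T I m x) [0..<n])"

definition upper_complexity ::
  "tm \<Rightarrow> ('a \<Rightarrow> 'a) \<Rightarrow> (nat \<Rightarrow> 'a set) \<Rightarrow> nat \<Rightarrow> 'a \<Rightarrow> ereal" where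
  "upper_complexity U T I m x =
     limsup (\<lambda>n. ereal_of_enat (orbit_AIC U T I m x n) / ereal (real n))"

end

theory Submission
  imports Defs "HOL-Real_Asymp.Real_Asymp"
begin

text \<open>
  Since \<open>\<tau>(Z_n(T x)) \<le> \<tau>(Z_{n+1}(x))\<close>, the sets \<open>{x. liminf \<tau>(Z_n(x)) / n^\<alpha> = 0}\<close> are mapped into
  themselves by \<open>T\<close>. A measurable set \<open>A\<close> with \<open>A \<subseteq> T\<^sup>-\<^sup>1 A\<close> is invariant up to a null set, because
  \<open>T\<^sup>-\<^sup>1 A - A\<close> is wandering; hence it is null or conull by ergodicity.

  If \<open>\<tau>(Z_n(x)) = i < n\<close>, then the word \<open>\<omega>_0 \<dots> \<omega>_{n-1}\<close> has period \<open>i\<close>. Take a prefix \<open>u\<close> of length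
  \<open>L = i (c + 1)\<close> with \<open>2^c\<close> about \<open>n\<close>. A Turing machine that carries a binary counter in the cells of
  \<open>u\<close> itself outputs \<open>u^r\<close> for any \<open>r \<le> 2^(L-1)\<close> from a program of length \<open>O(L)\<close>, so the prefix of length
  \<open>L (n div L) \<ge> n / 2\<close> has complexity \<open>O(i log n)\<close>. With \<open>i < n^\<alpha>\<close> and \<open>\<alpha> < \<beta>\<close> this is \<open>o(n^\<beta>)\<close>. This
  needs \<open>\<alpha> < 1\<close>; if \<open>\<alpha> \<ge> 1\<close> then \<open>\<beta> > 1\<close> and finiteness of the upper complexity suffices.
\<close>

section \<open>A machine for periodic words\<close>

text \<open>
  The tape is a queue of cells that moves to the right. First, the program is decoded: it consists
  of unary numbers \<open>c\<close>, each of which is erased and appended to the queue as one cell. Then cells are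
  popped, replaced on the tape by their letter \<open>c div 3\<close>, and appended at the right end, so that the
  trail left behind is the output. The value \<open>c mod 3\<close> is 2 in the first cell of the word; in the other
  cells it is a binary digit of a counter, least significant first. The argument of \<open>Rot\<close> is the
  borrow when the counter is decremented. The machine stops if there is a borrow in the first cell.
  In \<open>Carry q c\<close> it takes \<open>c\<close> to the right end; in \<open>Ret q\<close> it returns to the head of the queue and
  enters \<open>q\<close>.
\<close>

datatype state = Dec nat | Rot bool | Carry state nat | Ret state | Halt

instance state :: countable
  by countable_datatype

text \<open>Runs start in state \<open>0\<close>, so \<open>Dec 0\<close> must get the code
  \<open>0\<close>; the successor keeps all other codes away from it.\<close>

definition enc :: "state \<Rightarrow> nat" where
  "enc q = (if q = Dec 0 then 0 else Suc (to_nat q))"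

lemma enc_eq_iff: "enc q = enc q' \<longleftrightarrow> q = q'"
  by (auto simp: enc_def)

text \<open>For \<open>k \<ge> 1\<close> the offset separates cells from the blank, the letters
  \<open>1..k\<close> and the input bits \<open>1\<close> and \<open>2\<close>. Contents stay below
  \<open>3 * k\<close>, so all symbols in use are below \<open>4 * k + 2\<close>.\<close>

definition cell :: "nat \<Rightarrow> nat \<Rightarrow> nat" where
  "cell k c = k + 2 + c"

text \<open>Passing the marker issues a borrow, so each full turn of the queue subtracts 1 from the
  counter.\<close>

fun counter_step :: "bool \<Rightarrow> nat \<Rightarrow> bool \<times> nat" where
  "counter_step b c =
     (if c mod 3 = 2 then (True, c)
      else if b then (if c mod 3 = 0 then (True, c + 1) else (False, c - 1))
      else (False, c))"

text \<open>\<open>Ret\<close> moves left up to the symbol just before its target. Before the queue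
  this is a blank or, while rotating, possibly an output letter; before the output it is a
  blank.\<close>

fun stop_symbol :: "nat \<Rightarrow> state \<Rightarrow> nat \<Rightarrow> bool" where
  "stop_symbol k (Rot _) a = (a \<le> k)"
| "stop_symbol k _ a = (a = 0)"

fun trans :: "nat \<Rightarrow> state \<Rightarrow> nat \<Rightarrow> (state \<times> nat \<times> dir) option" where
  "trans k (Dec c) a =
     (if a = 1 then Some (Carry (Dec 0) c, 0, MoveR)
      else if a = 2 then Some (Dec (Suc c), 0, MoveR)
      else Some (Rot False, a, Stay))"
| "trans k (Rot b) a =
     (let c = a - (k + 2) in
      if b \<and> c mod 3 = 2 then Some (Ret Halt, a, MoveL)
      else Some (case counter_step b c of (b', c') \<Rightarrow> (Carry (Rot b') c', Suc (c div 3), MoveR)))"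
| "trans k (Carry q c) a =
     (if a = 0 then Some (Ret q, cell k c, MoveL) else Some (Carry q c, a, MoveR))"
| "trans k (Ret q) a = (if stop_symbol k q a then Some (q, a, MoveR) else Some (Ret q, a, MoveL))"
| "trans k Halt a = None"

definition states :: "nat \<Rightarrow> state set" where
  "states k =
     (let B = {Dec 0, Rot False, Rot True} in
      Dec ` {..<3 * k} \<union> B \<union> case_prod Carry ` (B \<times> {..<3 * k}) \<union> Ret ` insert Halt B \<union> {Halt})"

lemma finite_states: "finite (states k)"
  by (simp add: states_def Let_def)

definition simulates :: "nat \<Rightarrow> tm \<Rightarrow> bool" where
  "simulates k P \<longleftrightarrow> (\<forall>q\<in>states k. \<forall>a<4 * k + 2.
     map_of P (enc q, a) = map_option (\<lambda>(q', b, d). (enc q', b, d)) (trans k q a))"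

text \<open>Restricted to these states and symbols, the transition function has finite domain, and
  every finite partial map is the \<open>map_of\<close> of some list.\<close>

lemma ex_simulates: "\<exists>P. simulates k P"
proof -
  define dq where "dq = inv_into UNIV enc"
  have dq: "dq (enc q) = q" for q
    by (simp add: dq_def enc_eq_iff inj_def)
  define f where "f = (\<lambda>(q, a). map_option (\<lambda>(q', b, d). (enc q', b, d)) (trans k (dq q) a))
    |` (enc ` states k \<times> {..<4 * k + 2})"
  have "finite (dom f)"
    by (rule finite_subset[of _ "enc ` states k \<times> {..<4 * k + 2}"])
      (auto simp: f_def finite_states)
  then obtain xs where "set xs = dom f"
    using finite_list by blast
  then obtain P where P: "map_of P = f"
    using map_of_map_keys by metis
  then show ?thesis
    by (auto simp: simulates_def f_def dq intro!: exI[of _ P])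
qed

section \<open>Tapes as pairs of lists, and backward rules for runs\<close>

definition tape :: "nat list \<Rightarrow> nat list \<Rightarrow> int \<Rightarrow> int \<Rightarrow> nat" where
  "tape l r h = (\<lambda>j. if h \<le> j then nth_default 0 r (nat (j - h)) else nth_default 0 l (nat (h - 1 - j)))"

lemma tape_head: "tape l r h h = nth_default 0 r 0"
  by (simp add: tape_def)

lemma tape_right: "(tape l (x # r) h)(h := b) = tape (b # l) r (h + 1)"
proof
  fix j
  consider "j < h" | "j = h" | "j > h" by linarith
  then show "((tape l (x # r) h)(h := b)) j = tape (b # l) r (h + 1) j"
  proof cases
    case 1
    then have "nat (h + 1 - 1 - j) = Suc (nat (h - 1 - j))" by simp
    with 1 show ?thesis by (simp add: tape_def)
  next
    case 3
    then have "nat (j - h) = Suc (nat (j - (h + 1)))" by simp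
    with 3 show ?thesis by (simp add: tape_def)
  qed (simp add: tape_def)
qed

lemma tape_write: "(tape l (x # r) h)(h := b) = tape l (b # r) h"
  by (rule ext) (auto simp: tape_def nth_default_Cons split: nat.split)

lemma tape_write_empty: "(tape l [] h)(h := b) = tape l [b] h"
  by (rule ext) (auto simp: tape_def nth_default_Cons split: nat.split)

lemma tape_left: "tape (y # l) r h = tape l (y # r) (h - 1)"
proof
  fix j
  consider "j < h - 1" | "j = h - 1" | "j \<ge> h" by linarith
  then show "tape (y # l) r h j = tape l (y # r) (h - 1) j"
  proof cases
    case 1
    then have "nat (h - 1 - j) = Suc (nat (h - 1 - 1 - j))" by simp
    with 1 show ?thesis by (simp add: tape_def)
  next
    case 3
    then have "nat (j - (h - 1)) = Suc (nat (j - h))" by simp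
    with 3 show ?thesis by (simp add: tape_def)
  qed (simp add: tape_def)
qed

text \<open>\<open>l\<close> is the tape to the left of the head, read leftwards, and \<open>r\<close> the tape from the head on.\<close>

definition yields :: "nat \<Rightarrow> tm \<Rightarrow> state \<Rightarrow> nat list \<Rightarrow> nat list \<Rightarrow> nat list \<Rightarrow> bool" where
  "yields k P q l r out \<longleftrightarrow>
     (\<forall>h. map_option (tm_output k) (tm_run P (enc q, tape l r h, h)) = Some out)"

lemma tm_run_step: "tm_step P c = Some c' \<Longrightarrow> tm_run P c = tm_run P c'"
  by (subst tm_run.simps) simp

lemma tm_run_halt: "tm_step P c = None \<Longrightarrow> tm_run P c = Some c"
  by (subst tm_run.simps) simp

locale moving_queue =
  fixes k :: nat and P :: tm
  assumes sim: "simulates k P"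
begin

lemma step:
  assumes "q \<in> states k" "a < 4 * k + 2" "trans k q a = Some (q', b, d)" "t h = a"
  shows "tm_run P (enc q, t, h) = tm_run P (enc q', t(h := b), h + shift d)"
  using assms sim by (intro tm_run_step) (auto simp: tm_step_def simulates_def)

text \<open>Such rules are applied backwards: a configuration has the same final output as its
  successor.\<close>

lemma yields_right:
  assumes "trans k q a = Some (q', b, MoveR)" "q \<in> states k" "a < 4 * k + 2"
    and "yields k P q' (b # l) r out"
  shows "yields k P q l (a # r) out"
  using assms step[of q a q' b MoveR] by (simp add: yields_def tape_head tape_right)

lemma yields_stay:
  assumes "trans k q a = Some (q', b, Stay)" "q \<in> states k" "a < 4 * k + 2"
    and "yields k P q' l (b # r) out"
  shows "yields k P q l (a # r) out"
  using assms step[of q a q' b Stay] by (simp add: yields_def tape_head tape_write)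

lemma yields_left:
  assumes "trans k q a = Some (q', b, MoveL)" "q \<in> states k" "a < 4 * k + 2"
    and "yields k P q' l (y # b # r) out"
  shows "yields k P q (y # l) (a # r) out"
  using assms step[of q a q' b MoveL]
  by (simp add: yields_def tape_head tape_write tape_left[of y l "b # r"])

lemma yields_left_end:
  assumes "trans k q 0 = Some (q', b, MoveL)" "q \<in> states k"
    and "yields k P q' l [y, b] out"
  shows "yields k P q (y # l) [] out"
  using assms step[of q 0 q' b MoveL]
  by (simp add: yields_def tape_head tape_write_empty tape_left[of y l "[b]"])

lemma yields_carry:
  assumes "q \<in> {Dec 0, Rot False, Rot True}" "c < 3 * k"
    and "\<forall>a\<in>set w. a \<noteq> 0 \<and> a < 4 * k + 2"
    and "yields k P (Carry q c) (rev w @ l) [] out"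
  shows "yields k P (Carry q c) l w out"
  using assms(3,4)
proof (induction w arbitrary: l)
  case (Cons a w)
  then show ?case
    using assms(1,2) by (intro yields_right[where q' = "Carry q c" and b = a]) (auto simp: states_def Let_def)
qed simp

text \<open>Here \<open>v\<close> lists the symbols that \<open>Ret q\<close> crosses, from the head
  leftwards, and \<open>b\<close> is the stop symbol. If \<open>v\<close> is empty, the head is on
  \<open>b\<close> already; \<open>hd\<close> and \<open>tl\<close> cover both cases.\<close>

lemma yields_return:
  assumes "q \<in> {Dec 0, Rot False, Rot True, Halt}"
    and "\<forall>a\<in>set v. \<not> stop_symbol k q a \<and> a < 4 * k + 2" "stop_symbol k q b" "b < 4 * k + 2"
    and "yields k P q (b # l) (rev v @ r) out"
  shows "yields k P (Ret q) (tl (v @ b # l)) (hd (v @ b # l) # r) out"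
  using assms(2,5)
proof (induction v arbitrary: r)
  case Nil
  then show ?case
    using assms(1,3,4) by (auto intro!: yields_right simp: states_def Let_def)
next
  case (Cons a v)
  obtain y l' where y: "v @ b # l = y # l'"
    by (cases v) auto
  have "yields k P (Ret q) (y # l') (a # r) out"
    using assms(1) Cons.prems Cons.IH[of "a # r"] y
    by (intro yields_left[where q' = "Ret q" and b = a]) (auto simp: states_def Let_def)
  then show ?case by (simp add: y)
qed

text \<open>One full queue operation: \<open>x\<close> is popped and replaced by \<open>b\<close>,
  \<open>c\<close> travels past \<open>w\<close> to the first blank, and the head returns to the new
  front. The return must stop at \<open>b\<close>, so \<open>w\<close> contains no stop
  symbol.\<close>

lemma yields_pop_push:
  assumes "trans k q x = Some (Carry q' c, b, MoveR)" "q \<in> states k" "x < 4 * k + 2"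
    and q': "q' \<in> {Dec 0, Rot False, Rot True}" and c: "c < 3 * k"
    and w: "\<forall>a\<in>set w. a \<noteq> 0 \<and> \<not> stop_symbol k q' a \<and> a < 4 * k + 2"
    and b: "stop_symbol k q' b" "b < 4 * k + 2"
    and y: "yields k P q' (b # l) (w @ [cell k c]) out"
  shows "yields k P q l (x # w) out"
proof (rule yields_right[OF assms(1,2,3)], rule yields_carry[OF q' c])
  obtain y l' where yl: "rev w @ b # l = y # l'"
    by (cases "rev w") auto
  have "yields k P (Ret q') (tl (rev w @ b # l)) (hd (rev w @ b # l) # [cell k c]) out"
    using q' w b y by (intro yields_return) auto
  then show "yields k P (Carry q' c) (rev w @ b # l) [] out"
    unfolding yl using q' c
    by (intro yields_left_end[where q' = "Ret q'" and b = "cell k c"]) (auto simp: states_def Let_def)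
qed (use w in auto)

section \<open>Decoding the program\<close>

fun unary :: "nat \<Rightarrow> bool list" where
  "unary 0 = [False]"
| "unary (Suc c) = True # unary c"

abbreviation bit_symbols :: "bool list \<Rightarrow> nat list" where
  "bit_symbols \<equiv> map (\<lambda>b. Suc (of_bool b))"

text \<open>Induction on the ones still to be read, with \<open>d\<close> counting those already
  erased. Each erased bit adds a blank on the left, so the continuation is required for every
  \<open>l\<close>.\<close>

lemma yields_decode_cell:
  assumes "c + d < 3 * k" "\<forall>a\<in>set w. a \<noteq> 0 \<and> a < 4 * k + 2"
    and "\<And>l. yields k P (Dec 0) (0 # l) (w @ [cell k (c + d)]) out"
  shows "yields k P (Dec d) l (bit_symbols (unary c) @ w) out"
  using assms(1,3)
proof (induction c arbitrary: l d)
  case 0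
  then show ?case
    using assms(2) by (auto intro!: yields_pop_push[where q' = "Dec 0"] simp: states_def Let_def)
next
  case (Suc c)
  then show ?case
    by (auto intro!: yields_right[where q' = "Dec (Suc d)"] simp: states_def Let_def)
qed

text \<open>The cells \<open>ds\<close> decoded so far wait behind the rest of the program. When no
  bits are left, \<open>Dec 0\<close> meets a cell and rotation begins. The blank before the queue
  will mark where the output starts.\<close>

lemma yields_decode:
  assumes "\<forall>c\<in>set cs \<union> set ds. c < 3 * k"
    and "cs \<noteq> []" and "\<And>l. yields k P (Rot False) (0 # l) (map (cell k) (ds @ cs)) out"
  shows "yields k P (Dec 0) l (bit_symbols (concat (map unary cs)) @ map (cell k) ds) out"
  using assms
proof (induction cs arbitrary: l ds)
  case (Cons c cs)
  show ?case
  proof (simp, rule yields_decode_cell)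
    show "\<forall>a\<in>set (bit_symbols (concat (map unary cs)) @ map (cell k) ds). a \<noteq> 0 \<and> a < 4 * k + 2"
      using Cons.prems(1) by (fastforce simp: cell_def of_bool_def)
  next
    fix l
    show "yields k P (Dec 0) (0 # l)
      ((bit_symbols (concat (map unary cs)) @ map (cell k) ds) @ [cell k (c + 0)]) out"
    proof (cases "cs = []")
      case False
      then show ?thesis
        using Cons.IH[of "ds @ [c]" "0 # l"] Cons.prems by simp
    next
      case True
      obtain d ds' where d: "ds @ [c] = d # ds'" by (cases ds) auto
      then have "d \<in> set (ds @ [c])" by simp
      then have "d < 3 * k"
        using Cons.prems(1) by auto
      moreover have "yields k P (Rot False) (0 # l) (cell k d # map (cell k) ds') out"
        using Cons.prems(3)[of l] unfolding True d by simp
      moreover have "trans k (Dec 0) (cell k d) = Some (Rot False, cell k d, Stay)"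
        using \<open>d < 3 * k\<close> by (simp add: cell_def)
      moreover have "Dec 0 \<in> states k" "cell k d < 4 * k + 2"
        using \<open>d < 3 * k\<close> by (simp_all add: states_def Let_def cell_def)
      ultimately have "yields k P (Dec 0) (0 # l) (map (cell k) (ds @ [c])) out"
        unfolding d list.map by (blast intro: yields_stay)
      then show ?thesis
        using True by simp
    qed
  qed (use Cons.prems in auto)
qed simp


section \<open>Rotating the queue and counting down\<close>

lemma yields_rotate:
  assumes "counter_step b c = (b', c')" "\<not> (b \<and> c mod 3 = 2)" "\<forall>d\<in>set (c # c' # ds). d < 3 * k"
    and "yields k P (Rot b') (Suc (c div 3) # l) (map (cell k) (ds @ [c'])) out"
  shows "yields k P (Rot b) l (map (cell k) (c # ds)) out"
proof -
  have "trans k (Rot b) (cell k c) = Some (Carry (Rot b') c', Suc (c div 3), MoveR)"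
    using assms(1,2) by (auto simp: cell_def Let_def split: if_splits)
  \<comment> \<open>The printed letter is thus a stop symbol for \<open>Rot b'\<close>, and the
    return ends there.\<close>
  moreover have "Suc (c div 3) \<le> k"
    using assms(3) less_mult_imp_div_less[of c k 3] by (simp add: mult.commute)
  ultimately show ?thesis
    using assms(3,4) unfolding list.map
    by (intro yields_pop_push[where q' = "Rot b'"]) (auto simp: states_def Let_def cell_def)
qed

text \<open>The letters carry the binary digits of \<open>N\<close>, lowest first; only
  \<open>N\<close> modulo \<open>2 ^ length us\<close> is stored.\<close>

fun counter_cells :: "nat list \<Rightarrow> nat \<Rightarrow> nat list" where
  "counter_cells [] N = []"
| "counter_cells (u # us) N = (3 * u + N mod 2) # counter_cells us (N div 2)"

lemma digit_less: "u < k \<Longrightarrow> 3 * u + N mod 2 < 3 * k"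
  using mod_less_divisor[of 2 N] by linarith

lemma counter_cells_less: "\<forall>u\<in>set us. u < k \<Longrightarrow> c \<in> set (counter_cells us N) \<Longrightarrow> c < 3 * k"
  by (induction us arbitrary: N) (auto simp: digit_less)

lemma digit_simps:
  "(3 * u + N mod 2) div 3 = u" "(3 * u + N mod 2) mod 3 = N mod (2::nat)" "Suc (3 * u) div 3 = u"
  "(3 * u + 2) div 3 = u" "(3 * u + 2) mod 3 = 2"
  "Suc (Suc (3 * u)) div 3 = u" "Suc (Suc (3 * u)) mod 3 = 2"
proof -
  have "(3 * u + d) div 3 = u \<and> (3 * u + d) mod 3 = d" if "d < 3" for d
    using that by simp
  from this[of 1] this[of 2] this[of "N mod 2"] mod_less_divisor[of 2 N]
  show "(3 * u + N mod 2) div 3 = u" "(3 * u + N mod 2) mod 3 = N mod 2" "Suc (3 * u) div 3 = u"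
    "(3 * u + 2) div 3 = u" "(3 * u + 2) mod 3 = 2"
    "Suc (Suc (3 * u)) div 3 = u" "Suc (Suc (3 * u)) mod 3 = 2"
    by auto
qed

lemma yields_pass:
  assumes "\<forall>u\<in>set us. u < k" "\<forall>d\<in>set ds. d < 3 * k"
    and "yields k P (Rot False) (rev (map Suc us) @ l) (map (cell k) (ds @ counter_cells us N)) out"
  shows "yields k P (Rot False) l (map (cell k) (counter_cells us N @ ds)) out"
  using assms
proof (induction us arbitrary: N l ds)
  case (Cons u us)
  have "3 * u + N mod 2 < 3 * k"
    using Cons.prems(1) by (simp add: digit_less)
  then show ?case
    unfolding counter_cells.simps append_Cons
    using Cons.IH[of "ds @ [3 * u + N mod 2]" "Suc u # l" "N div 2"] Cons.prems
      counter_cells_less[of us _ "N div 2"]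
    by (intro yields_rotate[where b' = False and c' = "3 * u + N mod 2"])
      (auto simp: digit_simps)
qed simp

text \<open>Subtracting from zero turns every digit into 1, and the borrow survives the whole word.
  The new digits never matter later, since the machine stops at the marker; hence the arbitrary
  \<open>xs\<close>.\<close>

lemma yields_pass_zero:
  assumes "\<forall>u\<in>set us. u < k" "\<forall>d\<in>set ds. d < 3 * k"
    and "\<And>xs. yields k P (Rot True) (rev (map Suc us) @ l) (map (cell k) (ds @ xs)) out"
  shows "yields k P (Rot True) l (map (cell k) (counter_cells us 0 @ ds)) out"
  using assms
proof (induction us arbitrary: l ds)
  case (Cons u us)
  have "3 * u + 1 < 3 * k"
    using Cons.prems(1) by simp
  then show ?case
    unfolding counter_cells.simps append_Cons 
    using Cons.IH[of "ds @ [3 * u + 1]" "Suc u # l"] Cons.prems(1,2) Cons.prems(3)[of "(3 * u + 1) # xs" for xs]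
      counter_cells_less[of us _ 0]
    by (intro yields_rotate[where b' = True and c' = "3 * u + 1"]) auto
next
  case Nil
  then show ?case
    using Nil(3)[of "[]"] by simp
qed

text \<open>If \<open>N\<close> is odd, the borrow ends at the first digit and the other cells pass
  unchanged. If \<open>N\<close> is even, that digit becomes 1 and the borrow goes on to
  \<open>N div 2\<close>, which is still positive.\<close>

lemma yields_pass_pos:
  assumes "\<forall>u\<in>set us. u < k" "\<forall>d\<in>set ds. d < 3 * k" "0 < N" "N < 2 ^ length us"
    and "yields k P (Rot False) (rev (map Suc us) @ l)
      (map (cell k) (ds @ counter_cells us (N - 1))) out"
  shows "yields k P (Rot True) l (map (cell k) (counter_cells us N @ ds)) out"
  using assms
proof (induction us arbitrary: N l ds)
  case (Cons u us)
  have u: "3 * u + 1 < 3 * k"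
    using Cons.prems(1) by simp
  note less = counter_cells_less[of us _ "N div 2"]
  show ?case
  proof (cases "even N")
    case True
    then obtain N' where N: "N = 2 * Suc N'"
      using Cons.prems(3) by (metis evenE mult_0_right not0_implies_Suc less_nat_zero_code)
    have "yields k P (Rot True) (Suc u # l) (map (cell k) (counter_cells us (Suc N') @ ds @ [3 * u + 1])) out"
      using Cons.prems u unfolding N by (intro Cons.IH) auto
    then show ?thesis
      unfolding counter_cells.simps append_Cons N using Cons.prems(1,2) less u
      by (intro yields_rotate[where b' = True and c' = "3 * u + 1"]) (auto simp: N)
  next
    case False
    then obtain N' where N: "N = 2 * N' + 1"
      by (rule oddE)
    have "yields k P (Rot False) (Suc u # l) (map (cell k) (counter_cells us N' @ ds @ [3 * u])) out"
      using Cons.prems u unfolding N by (intro yields_pass) auto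
    then show ?thesis
      unfolding counter_cells.simps append_Cons N using Cons.prems(1,2) less u
      by (intro yields_rotate[where b' = False and c' = "3 * u"]) (auto simp: N digit_simps)
  qed
qed simp

lemma yields_Halt:
  assumes "\<forall>u\<in>set us. u < k" "k < a" "a < 4 * k + 2"
  shows "yields k P Halt l (map Suc us @ a # r) us"
  unfolding yields_def
proof
  fix h
  let ?t = "tape l (map Suc us @ a # r) h"
  have t: "?t (h + int j) = (if j < length us then Suc (us ! j) else a)" if "j \<le> length us" for j
    using that by (auto simp: tape_def nth_default_def nth_append)
  have "(LEAST j. ?t (h + int j) \<notin> {1..k}) = length us"
  proof (rule Least_equality)
    show "?t (h + int (length us)) \<notin> {1..k}"
      using assms t by simp
    show "length us \<le> j" if "?t (h + int j) \<notin> {1..k}" for j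
      using that assms(1) t[of j] by (cases "j < length us") (auto simp: Suc_le_eq)
  qed
  then have "tm_output k (enc Halt, ?t, h) = us"
    using t by (auto simp: tm_output_def intro!: nth_equalityI)
  moreover have "tm_step P (enc Halt, ?t, h) = None"
  proof -
    \<comment> \<open>\<open>simulates\<close> speaks only of symbols below this bound; within it,
      no entry applies in state \<open>Halt\<close>.\<close>
    have "?t h < 4 * k + 2"
      using assms t[of 0] nth_mem[of 0 us] by (fastforce split: if_splits)
    then have "map_of P (enc Halt, ?t h) = None"
      using sim by (auto simp: simulates_def states_def Let_def)
    then show ?thesis
      by (simp add: tm_step_def)
  qed
  ultimately show "map_option (tm_output k) (tm_run P (enc Halt, ?t, h)) = Some us"
    by (simp add: tm_run_halt)
qed

text \<open>\<open>Ret Halt\<close> crosses the output leftwards to the blank in front of it, so the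
  head ends at the start of the output; the marker cell is no letter and closes the output on the
  right.\<close>

lemma yields_finish:
  assumes "\<forall>u\<in>set us. u < k" "c < 3 * k" "c mod 3 = 2"
  shows "yields k P (Rot True) (rev (map Suc us) @ 0 # l) (map (cell k) (c # ds)) us"
proof -
  obtain y l' where y: "rev (map Suc us) @ 0 # l = y # l'"
    by (cases "rev (map Suc us)") auto
  have "yields k P (Ret Halt) (tl (rev (map Suc us) @ 0 # l))
      (hd (rev (map Suc us) @ 0 # l) # map (cell k) (c # ds)) us"
    using assms yields_Halt[of us "cell k c" "0 # l"]
    by (intro yields_return) (auto simp: cell_def rev_map)
  then show ?thesis
    unfolding y list.map using assms
    by (intro yields_left[where q' = "Ret Halt" and b = "cell k c"])
      (auto simp: cell_def states_def Let_def)
qed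

text \<open>\<open>vs\<close> is the output so far. Each turn prints one copy and lowers the
  counter; the turn that finds it at 0 still prints its copy, which gives \<open>Suc N\<close>. The
  marker cell holds no digit, so there are \<open>length us\<close> bits.\<close>

lemma yields_count:
  assumes u: "\<forall>u\<in>set (u # us). u < k" "\<forall>u\<in>set vs. u < k" and "N < 2 ^ length us"
  shows "yields k P (Rot False) (rev (map Suc vs) @ 0 # l)
    (map (cell k) ((3 * u + 2) # counter_cells us N)) (vs @ concat (replicate (Suc N) (u # us)))"
  using assms(2,3)
proof (induction N arbitrary: vs)
  case 0
  let ?l = "rev (map Suc (vs @ u # us)) @ 0 # l"
  have "yields k P (Rot True) ?l (map (cell k) ((3 * u + 2) # xs)) (vs @ u # us)" for xs
    using u 0 by (intro yields_finish) (auto simp: digit_simps)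
  then have "yields k P (Rot True) (Suc u # rev (map Suc vs) @ 0 # l)
      (map (cell k) (counter_cells us 0 @ [3 * u + 2])) (vs @ u # us)"
    using u by (intro yields_pass_zero) auto
  then show ?case
    using u counter_cells_less[of us _ 0]
    by (intro yields_rotate[where b' = True and c' = "3 * u + 2"]) (auto simp: digit_simps)
next
  case (Suc N)
  have "yields k P (Rot False) (rev (map Suc (vs @ u # us)) @ 0 # l)
    (map (cell k) ((3 * u + 2) # counter_cells us N)) ((vs @ u # us) @ concat (replicate (Suc N) (u # us)))"
    using Suc.prems u by (intro Suc.IH) auto
  then have "yields k P (Rot True) (Suc u # rev (map Suc vs) @ 0 # l)
      (map (cell k) (counter_cells us (Suc N) @ [3 * u + 2]))
      (vs @ concat (replicate (Suc (Suc N)) (u # us)))"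
    using u Suc.prems by (intro yields_pass_pos) auto
  then show ?case
    using u counter_cells_less[of us _ "Suc N"]
    by (intro yields_rotate[where b' = True and c' = "3 * u + 2"]) (auto simp: digit_simps)
qed

lemma length_unary: "length (unary c) = Suc c"
  by (induction c) auto

lemma length_counter_cells: "length (counter_cells us N) = length us"
  by (induction us arbitrary: N) auto

lemma tm_init_eq: "tm_init p = (enc (Dec 0), tape [] (bit_symbols p) 0, 0)"
  by (auto simp: tm_init_def tape_def enc_def nth_default_def fun_eq_iff)

text \<open>The program is the unary code of the initial queue; a cell \<open>c < 3 * k\<close>
  costs \<open>Suc c \<le> 3 * k\<close> bits.\<close>

lemma ex_program:
  assumes u: "\<forall>u\<in>set (u # us). u < k" and N: "N < 2 ^ length us"
  shows "\<exists>p. length p \<le> 3 * k * length (u # us) \<and>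
    tm_eval k P p = Some (concat (replicate (Suc N) (u # us)))"
proof (intro exI conjI)
  let ?cs = "(3 * u + 2) # counter_cells us N"
  let ?p = "concat (map unary ?cs)"
  have less: "\<forall>c\<in>set ?cs. c < 3 * k"
    using u counter_cells_less[of us _ N] by auto
  have "length ?p = (\<Sum>c\<leftarrow>?cs. Suc c)"
    by (simp add: length_concat comp_def length_unary)
  also have "\<dots> \<le> (\<Sum>c\<leftarrow>?cs. 3 * k)"
    using less by (intro sum_list_mono) auto
  also have "\<dots> = 3 * k * length (u # us)"
    by (simp add: sum_list_triv length_counter_cells)
  finally show "length ?p \<le> 3 * k * length (u # us)" .
  have "yields k P (Dec 0) [] (bit_symbols ?p @ map (cell k) []) (concat (replicate (Suc N) (u # us)))"
    using less N u yields_count[of u us "[]" N] by (intro yields_decode) auto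
  then show "tm_eval k P ?p = Some (concat (replicate (Suc N) (u # us)))"
    by (simp add: tm_eval_def yields_def tm_init_eq del: counter_cells.simps unary.simps)
qed

end

section \<open>Periodic words have small information content\<close>

lemma liminf_eq_0_iff:
  fixes f :: "nat \<Rightarrow> ereal"
  assumes "\<And>n. 0 \<le> f n"
  shows "liminf f = 0 \<longleftrightarrow> (\<forall>e>0. \<exists>\<^sub>F n in sequentially. f n < ereal e)"
proof -
  have "0 \<le> liminf f"
    using assms by (intro Liminf_bounded) auto
  then have "liminf f = 0 \<longleftrightarrow> \<not> 0 < liminf f"
    by auto
  also have "\<dots> \<longleftrightarrow> \<not> (\<exists>e>0. \<forall>\<^sub>F n in sequentially. ereal e \<le> f n)"
  proof -
    have "0 < liminf f \<longleftrightarrow> (\<exists>e>0. \<forall>\<^sub>F n in sequentially. ereal e \<le> f n)"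
    proof
      assume "0 < liminf f"
      then obtain y where y: "0 < y" "\<forall>\<^sub>F n in sequentially. y < f n"
        by (metis dense less_LiminfD)
      then obtain e where "0 < ereal e" "ereal e < y"
        using ereal_dense2 by blast
      with y(2) show "\<exists>e>0. \<forall>\<^sub>F n in sequentially. ereal e \<le> f n"
        by (intro exI[of _ e]) (auto elim: eventually_mono)
    next
      assume "\<exists>e>0. \<forall>\<^sub>F n in sequentially. ereal e \<le> f n"
      then obtain e where "e > 0" "ereal e \<le> liminf f"
        using Liminf_bounded by blast
      then show "0 < liminf f"
        by (meson ereal_less(2) less_le_trans)
    qed
    then show ?thesis by simp
  qed
  finally show ?thesis
    unfolding frequently_def not_less by blast
qed

lemma enat_quotient_less_iff:
  assumes "n \<ge> 1"
  shows "ereal_of_enat t / ereal (real n powr \<alpha>) < ereal e \<longleftrightarrow>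
    (\<exists>j. t = enat j \<and> real j < e * real n powr \<alpha>)"
proof (cases t)
  case (enat j)
  then show ?thesis
    using assms by (simp add: divide_less_eq)
next
  case infinity
  then show ?thesis
    using assms by (simp add: divide_ereal_def)
qed

lemma liminf_enat_quotient_eq_0_iff:
  "liminf (\<lambda>n. ereal_of_enat (t n) / ereal (real n powr \<alpha>)) = 0 \<longleftrightarrow>
    (\<forall>e>0. \<exists>\<^sub>F n in sequentially. \<exists>j. t n = enat j \<and> real j < e * real n powr \<alpha>)"
proof (subst liminf_eq_0_iff)
  show "0 \<le> ereal_of_enat (t n) / ereal (real n powr \<alpha>)" for n
    by (cases "n = 0"; cases "t n") (auto simp: zero_le_divide_ereal divide_ereal_def)
  have "(\<exists>\<^sub>F n in sequentially. ereal_of_enat (t n) / ereal (real n powr \<alpha>) < ereal e) \<longleftrightarrow>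
    (\<exists>\<^sub>F n in sequentially. \<exists>j. t n = enat j \<and> real j < e * real n powr \<alpha>)" for e
    by (intro frequently_cong[OF eventually_ge_at_top[of 1]] enat_quotient_less_iff)
  then show "(\<forall>e>0. \<exists>\<^sub>F n in sequentially. ereal_of_enat (t n) / ereal (real n powr \<alpha>) < ereal e) \<longleftrightarrow>
    (\<forall>e>0. \<exists>\<^sub>F n in sequentially. \<exists>j. t n = enat j \<and> real j < e * real n powr \<alpha>)"
    by simp
qed

section \<open>Information content of prefixes of periodic words\<close>

lemma concat_replicate_period:
  assumes "\<And>l. l + L < n \<Longrightarrow> s (l + L) = s l" "r * L \<le> n"
  shows "concat (replicate r (map s [0..<L])) = map s [0..<r * L]"
  using assms(2)
proof (induction r)
  case (Suc r)
  have "map s [0..<Suc r * L] = map s [0..<L] @ map s [L..<L + r * L]"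
    by (simp add: upt_add_eq_append[of 0 L "r * L", simplified])
  also have "map s [L..<L + r * L] = map s [0..<r * L]"
    using Suc.prems assms(1) by (intro nth_equalityI) (auto simp: add.commute)
  finally show ?case
    using Suc by simp
qed simp

lemma period_mult:
  fixes s :: "nat \<Rightarrow> 'b"
  assumes "\<And>l. l + i < n \<Longrightarrow> s (l + i) = s l"
  shows "l + i * c < n \<Longrightarrow> s (l + i * c) = s l"
proof (induction c)
  case (Suc c)
  then show ?case
    using assms[of "l + i * c"] by (simp add: algebra_simps)
qed simp

text \<open>Invariance up to a constant: \<open>D\<close> is the length of the self-delimiting
  prefix by which \<open>U\<close> selects \<open>P\<close>.\<close>

lemma AIC_le:
  assumes "computable_enumeration A" "universal_tm k A U"
  shows "\<exists>D. \<forall>p s. tm_eval k P p = Some s \<longrightarrow> AIC k U s \<le> enat (D + length p)"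
proof -
  obtain n where n: "n \<ge> 1" "A n = P"
    using assms(1) by (auto simp: computable_enumeration_def)
  have "AIC k U s \<le> enat (length (hat (bin_string n)) + length p)" if "tm_eval k P p = Some s" for p s
  proof -
    have "tm_eval k U (hat (bin_string n) @ p) = Some s"
      using assms(2) n that by (simp add: universal_tm_def)
    then show ?thesis
      unfolding AIC_def by (rule INF_lower2[OF CollectI]) simp
  qed
  then show ?thesis by blast
qed

text \<open>The block length \<open>i * (c + 1)\<close> is a multiple of the period, so copies of
  the block spell the word, and it leaves at least \<open>c\<close> digit cells, enough to count up
  to \<open>n\<close> and hence to the number of copies.\<close>

lemma AIC_periodic_word:
  fixes f :: "nat list \<Rightarrow> enat"
  assumes AIC: "\<And>u us N. \<forall>u\<in>set (u # us). u < k \<Longrightarrow> N < 2 ^ length us \<Longrightarrow>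
      f (concat (replicate (Suc N) (u # us))) \<le> enat (D + 3 * k * length (u # us))"
    and s: "\<And>j. s j < k" and i: "0 < i" "\<And>l. l + i < n \<Longrightarrow> s (l + i) = s l"
    and c: "n < 2 ^ c" "i * (c + 1) \<le> n"
  shows "\<exists>n'. n \<le> 2 * n' \<and> f (map s [0..<n']) \<le> enat (D + 3 * k * (i * (c + 1)))"
proof -
  define L where "L = i * (c + 1)"
  define r where "r = n div L"
  have "i * (c + 1) \<ge> 1 * (c + 1)"
    using i by (intro mult_right_mono) auto
  then have L: "c + 1 \<le> L" "L \<le> n"
    using c by (simp_all add: L_def)
  then have r: "1 \<le> r" "r * L \<le> n" "n < (r + 1) * L" "r \<le> n"
    unfolding r_def using div_greater_zero_iff[of n L] dividend_less_div_times[of L n]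
    by (auto simp: div_times_less_eq_dividend)
  have eq: "concat (replicate r (map s [0..<L])) = map s [0..<r * L]"
    using r(2) unfolding L_def by (intro concat_replicate_period period_mult i) auto
  obtain u us where u: "map s [0..<L] = u # us"
    using L by (cases "map s [0..<L]") auto
  then have len: "length (u # us) = L"
    by (metis diff_zero length_map length_upt)
  have "r - 1 < 2 ^ c"
    using r c by linarith
  also have "\<dots> \<le> 2 ^ length us"
    using len L by (intro power_increasing) auto
  finally have "f (concat (replicate (Suc (r - 1)) (u # us))) \<le> enat (D + 3 * k * length (u # us))"
    using s u by (intro AIC) (auto simp flip: u)
  \<comment> \<open>As \<open>r \<ge> 1\<close>, rounding \<open>n\<close> down to a multiple of
    \<open>L\<close> loses at most half.\<close>
  moreover have "n \<le> 2 * (r * L)"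
    using r(3) mult_le_mono1[OF r(1), of L] unfolding add_mult_distrib by linarith
  ultimately show ?thesis
    using r eq unfolding len u[symmetric] by (intro exI[of _ "r * L"]) (simp add: L_def)
qed

text \<open>Two requirements for large \<open>n\<close>: the block fits into the word, which uses
  \<open>\<alpha> < 1\<close>, and its program is short against the power \<open>\<beta>\<close> of
  \<open>n / 2\<close>, a lower bound for the length of the prefix obtained.\<close>

lemma powr_log_bounds:
  assumes "0 < \<alpha>" "\<alpha> < \<beta>" "\<alpha> < 1" "0 < e"
  shows "\<forall>\<^sub>F n in sequentially. real n powr \<alpha> * (log 2 (real n) + 2) \<le> real n"
    and "\<forall>\<^sub>F n in sequentially. D + C * (real n powr \<alpha> * (log 2 (real n) + 2)) < e * (real n / 2) powr \<beta>"
proof -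
  have lim: "((\<lambda>n. real n powr \<alpha> * (log 2 (real n) + 2) / real n powr \<gamma>) \<longlongrightarrow> 0) sequentially"
    if "\<alpha> < \<gamma>" for \<gamma>
    using that assms by real_asymp
  show "\<forall>\<^sub>F n in sequentially. real n powr \<alpha> * (log 2 (real n) + 2) \<le> real n"
    using order_tendstoD(2)[OF lim[OF assms(3)] zero_less_one] eventually_gt_at_top[of 0]
    by eventually_elim (auto simp: divide_less_eq)
  have "((\<lambda>n. D * real n powr (-\<beta>) + C * (real n powr \<alpha> * (log 2 (real n) + 2) / real n powr \<beta>)) \<longlongrightarrow> D * 0 + C * 0) sequentially"
    using assms
    by (intro tendsto_add tendsto_mult tendsto_const lim tendsto_neg_powr filterlim_real_sequentially) auto
  then have "\<forall>\<^sub>F n in sequentially. D * real n powr (-\<beta>) + C * (real n powr \<alpha> * (log 2 (real n) + 2) / real n powr \<beta>) < e / 2 powr \<beta>"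
    using assms(4) by (intro order_tendstoD(2)) auto
  then show "\<forall>\<^sub>F n in sequentially. D + C * (real n powr \<alpha> * (log 2 (real n) + 2)) < e * (real n / 2) powr \<beta>"
    using eventually_gt_at_top[of 0]
  proof eventually_elim
    case (elim n)
    have "D + C * (real n powr \<alpha> * (log 2 (real n) + 2)) =
      (D * real n powr (-\<beta>) + C * (real n powr \<alpha> * (log 2 (real n) + 2) / real n powr \<beta>)) * real n powr \<beta>"
      using elim(2) by (simp add: powr_minus field_simps)
    also have "\<dots> < e / 2 powr \<beta> * real n powr \<beta>"
      using elim by (intro mult_strict_right_mono) auto
    finally show ?case
      by (simp add: powr_divide)
  qed
qed

lemma liminf_periodic_words:
  fixes f :: "nat list \<Rightarrow> enat"
  assumes AIC: "\<And>u us N. \<forall>u\<in>set (u # us). u < k \<Longrightarrow> N < 2 ^ length us \<Longrightarrow>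
      f (concat (replicate (Suc N) (u # us))) \<le> enat (D + 3 * k * length (u # us))"
    and s: "\<And>j. s j < k"
    and \<alpha>: "0 < \<alpha>" "\<alpha> < \<beta>" "\<alpha> < 1"
    and per: "\<exists>\<^sub>F n in sequentially. \<exists>i>0. real i < real n powr \<alpha> \<and>
      (\<forall>l. l + i < n \<longrightarrow> s (l + i) = s l)"
  shows "liminf (\<lambda>n. ereal_of_enat (f (map s [0..<n])) / ereal (real n powr \<beta>)) = 0"
  unfolding liminf_enat_quotient_eq_0_iff
proof safe
  fix e :: real assume e: "0 < e"
  show "\<exists>\<^sub>F n in sequentially. \<exists>j. f (map s [0..<n]) = enat j \<and> real j < e * real n powr \<beta>"
    unfolding frequently_sequentially
  proof
    fix N
    have "\<forall>\<^sub>F n in sequentially. real n powr \<alpha> * (log 2 (real n) + 2) \<le> real n \<and>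
      real D + real (3 * k) * (real n powr \<alpha> * (log 2 (real n) + 2)) < e * (real n / 2) powr \<beta> \<and>
      2 * N + 1 \<le> n"
      by (intro eventually_conj powr_log_bounds[OF \<alpha> e] eventually_ge_at_top)
    \<comment> \<open>Since \<open>n \<le> 2 * n'\<close> below, \<open>2 * N + 1 \<le> n\<close>
      makes the prefix length \<open>n'\<close> at least \<open>N\<close>.\<close>
    from frequently_ex[OF frequently_eventually_conj[OF per this]]
    obtain n i where n: "real n powr \<alpha> * (log 2 (real n) + 2) \<le> real n"
      "real D + real (3 * k) * (real n powr \<alpha> * (log 2 (real n) + 2)) < e * (real n / 2) powr \<beta>"
      "2 * N + 1 \<le> n"
      and i: "i > 0" "real i < real n powr \<alpha>" "\<And>l. l + i < n \<Longrightarrow> s (l + i) = s l"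
      by blast
    \<comment> \<open>The exponent passed on is \<open>c + 1\<close>, so the block has
      \<open>i * (c + 2)\<close> cells; this explains the \<open>+ 2\<close> next to the
      logarithm.\<close>
    obtain c where c: "2 ^ c \<le> n" "n < 2 ^ (c + 1)"
      using ex_power_ivl1[of 2 n] n by auto
    have "real c \<le> log 2 (real n)"
      using c n by (simp add: le_log2_of_power)
    then have *: "real (i * (c + 1 + 1)) \<le> real n powr \<alpha> * (log 2 (real n) + 2)"
      using i unfolding of_nat_mult by (intro mult_mono) auto
    then have "i * (c + 1 + 1) \<le> n"
      using n(1) by linarith
    then obtain n' where n': "n \<le> 2 * n'" "f (map s [0..<n']) \<le> enat (D + 3 * k * (i * (c + 1 + 1)))"
      using AIC_periodic_word[where f = f and s = s and k = k and D = D and i = i and n = n and c = "c + 1"]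
        AIC s i(1,3) c(2) by blast
    then obtain j where j: "f (map s [0..<n']) = enat j" "j \<le> D + 3 * k * (i * (c + 1 + 1))"
      by (cases "f (map s [0..<n'])") auto
    have "real j \<le> real D + real (3 * k) * real (i * (c + 1 + 1))"
      using j(2) by (simp only: of_nat_add[symmetric] of_nat_mult[symmetric] of_nat_le_iff)
    also have "\<dots> \<le> real D + real (3 * k) * (real n powr \<alpha> * (log 2 (real n) + 2))"
      using * by (intro add_left_mono mult_left_mono) auto
    also have "\<dots> < e * (real n / 2) powr \<beta>"
      by (rule n(2))
    also have "\<dots> \<le> e * real n' powr \<beta>"
      using n' e \<alpha> by (intro mult_left_mono powr_mono2) auto
    finally show "\<exists>n\<ge>N. \<exists>j. f (map s [0..<n]) = enat j \<and> real j < e * real n powr \<beta>"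
      using j(1) n(3) n'(1) by (intro exI[of _ n']) auto
  qed
qed

text \<open>Eventually \<open>t n < C * n\<close>, and \<open>n powr (1 - \<beta>)\<close> tends to
  0. This serves exponents \<open>\<alpha> \<ge> 1\<close>, where the block need not fit into the
  word.\<close>

lemma liminf_quotient_powr_eq_0:
  assumes lim: "limsup (\<lambda>n. ereal_of_enat (t n) / ereal (real n)) < \<infinity>" and \<beta>: "1 < \<beta>"
  shows "liminf (\<lambda>n. ereal_of_enat (t n) / ereal (real n powr \<beta>)) = 0"
  unfolding liminf_enat_quotient_eq_0_iff
proof safe
  fix e :: real assume e: "0 < e"
  obtain C where "limsup (\<lambda>n. ereal_of_enat (t n) / ereal (real n)) < ereal C"
    using lim less_PInf_Ex_of_nat by force
  then have "\<forall>\<^sub>F n in sequentially. ereal_of_enat (t n) / ereal (real n powr 1) < ereal C"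
    using Limsup_lessD by force
  moreover have "(\<lambda>n. C * real n powr (1 - \<beta>)) \<longlonglongrightarrow> C * 0"
    using \<beta> by (intro tendsto_intros tendsto_neg_powr filterlim_real_sequentially) auto
  then have "\<forall>\<^sub>F n in sequentially. C * real n powr (1 - \<beta>) < e"
    using e by (intro order_tendstoD(2)) auto
  ultimately have "\<forall>\<^sub>F n in sequentially. \<exists>j. t n = enat j \<and> real j < e * real n powr \<beta>"
    using eventually_ge_at_top[of 1]
  proof eventually_elim
    case (elim n)
    then obtain j where j: "t n = enat j" "real j < C * real n powr 1"
      using enat_quotient_less_iff by blast
    have "C * real n powr 1 = C * real n powr (1 - \<beta>) * real n powr \<beta>"
      by (simp add: powr_add[symmetric] mult.assoc)
    also have "\<dots> < e * real n powr \<beta>"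
      using elim by (intro mult_strict_right_mono) auto
    finally show ?case
      using j by auto
  qed
  then show "\<exists>\<^sub>F n in sequentially. \<exists>j. t n = enat j \<and> real j < e * real n powr \<beta>"
    by (rule eventually_frequently[rotated]) simp
qed

section \<open>Recurrence times of cylinders\<close>

lemma conservative_null:
  assumes T: "T \<in> measurable M M" and cons: "conservative M T"
    and A: "A \<in> sets M" "A \<subseteq> T -` A"
  shows "(T -` A \<inter> space M) - A \<in> null_sets M"
proof -
  define B where "B n = (T ^^ n) -` A \<inter> space M" for n
  have B: "B n \<in> sets M" for n
    unfolding B_def using A(1) T by (intro measurable_sets[OF measurable_compose_n]) auto
  let ?W = "(T -` A \<inter> space M) - A"
  \<comment> \<open>The preimages of \<open>?W\<close> are the increments of the increasing sequence
    \<open>B\<close>, hence disjoint.\<close>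
  have W: "(T ^^ n) -` ?W \<inter> space M = B (Suc n) - B n" for n
    using measurable_space[OF measurable_compose_n[OF T, of n]] by (auto simp: B_def)
  have "B n \<subseteq> B (Suc n)" for n
    using A(2) by (auto simp: B_def)
  then have "incseq B"
    by (rule incseq_SucI)
  then have "B (Suc i) \<subseteq> B j" if "i < j" for i j
    using that incseqD[of B "Suc i" j] by auto
  then have "disjoint_family (\<lambda>n. (T ^^ n) -` ?W \<inter> space M)"
    unfolding W disjoint_family_on_def by (metis (no_types, lifting) DiffD1 DiffD2 disjoint_iff linorder_neqE_nat subsetD)
  moreover have "?W \<in> sets M"
    using A(1) T by auto
  ultimately show ?thesis
    using cons unfolding conservative_def wandering_set_def null_sets_def by blast
qed

text \<open>The increasing preimages \<open>B n\<close> have a strictly invariant union, which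
  ergodicity makes null or conull. Each increment is null, so \<open>A\<close> agrees with the union
  almost everywhere.\<close>

lemma zero_one:
  assumes T: "T \<in> measurable M M" and erg: "ergodic M T" and cons: "conservative M T"
    and A: "A \<in> sets M" "A \<subseteq> T -` A"
  shows "(AE x in M. x \<in> A) \<or> (AE x in M. x \<notin> A)"
proof -
  define B where "B n = (T ^^ n) -` A \<inter> space M" for n
  have B: "B n \<in> sets M" for n
    unfolding B_def using A(1) T by (intro measurable_sets[OF measurable_compose_n]) auto
  have TB: "T -` B n \<inter> space M = B (Suc n)" for n
    using measurable_space[OF T] by (auto simp: B_def funpow_swap1)
  have B_mono: "B n \<subseteq> B (Suc n)" for n
    using A(2) by (auto simp: B_def)
  have B0: "B 0 = A"
    using A(1) sets.sets_into_space by (auto simp: B_def)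
  have "B n \<subseteq> T -` B n" for n
    using B_mono[of n] TB[of n] by auto
  then have step: "B (Suc n) - B n \<in> null_sets M" for n
    using conservative_null[OF T cons B[of n]] TB[of n] by auto
  have AE_B: "AE x in M. x \<in> B n \<longrightarrow> x \<in> A" for n
  proof (induction n)
    case (Suc n)
    with AE_not_in[OF step[of n]] show ?case
      by eventually_elim auto
  qed (simp add: B0)
  let ?A = "\<Union>n. B n"
  have "T -` ?A \<inter> space M = (\<Union>n. B (Suc n))"
    using TB by auto
  also have "\<dots> = ?A"
    using B_mono by auto
  finally have "emeasure M ?A = 0 \<or> emeasure M (space M - ?A) = 0"
    using erg B unfolding ergodic_def by blast
  moreover have sets: "?A \<in> sets M" "space M - ?A \<in> sets M"
    using B by auto
  ultimately consider "?A \<in> null_sets M" | "space M - ?A \<in> null_sets M"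
    by auto
  then show ?thesis
  proof cases
    case 1
    from AE_not_in[OF this] have "AE x in M. x \<notin> A"
      by eventually_elim (use B0 in auto)
    then show ?thesis ..
  next
    case 2
    from AE_not_in[OF this] have "AE x in M. x \<in> ?A"
      using AE_space by eventually_elim auto
    moreover have "AE x in M. \<forall>n. x \<in> B n \<longrightarrow> x \<in> A"
      using AE_B by (subst AE_all_countable) blast
    ultimately have "AE x in M. x \<in> A"
      by eventually_elim auto
    then show ?thesis ..
  qed
qed

section \<open>Recurrence times and symbolic words\<close>

lemma recurrence_time_le: "0 < j \<Longrightarrow> (T ^^ j) ` A \<inter> A \<noteq> {} \<Longrightarrow> recurrence_time T A \<le> enat j"
  unfolding recurrence_time_def by (rule INF_lower) simp

lemma recurrence_time_attained:
  assumes "recurrence_time T A = enat j"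
  obtains i where "0 < i" "i \<le> j" "(T ^^ i) ` A \<inter> A \<noteq> {}"
proof -
  have "recurrence_time T A < enat (Suc j)"
    using assms by simp
  then obtain i where "0 < i" "(T ^^ i) ` A \<inter> A \<noteq> {}" "i < Suc j"
    unfolding recurrence_time_def INF_less_iff by auto
  then show ?thesis
    using that by simp
qed

lemma symbol_funpow_Suc: "symbol T I m (T x) j = symbol T I m x (Suc j)"
  by (simp add: symbol_def funpow_swap1)

locale coded_system =
  fixes M :: "'a measure" and T :: "'a \<Rightarrow> 'a" and Z :: "'a set set"
    and I :: "nat \<Rightarrow> 'a set" and m :: nat
  assumes T: "T \<in> measurable M M"
    and Z: "finite_measurable_partition M Z" and I: "bij_betw I {..m} Z"
begin

abbreviation "letter \<equiv> symbol T I m"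

lemma funpow_space: "x \<in> space M \<Longrightarrow> (T ^^ j) x \<in> space M"
  by (rule measurable_space[OF measurable_compose_n[OF T]])

lemma letter_eqI: assumes "x \<in> space M" "i \<le> m" "(T ^^ j) x \<in> I i" shows "letter x j = i"
  unfolding symbol_def
proof (rule the_equality)
  fix i' assume i': "i' \<le> m \<and> (T ^^ j) x \<in> I i'"
  with assms have "I i \<inter> I i' \<noteq> {}" "I i \<in> Z" "I i' \<in> Z"
    using I by (auto simp: bij_betw_def)
  then have "I i' = I i"
    using Z unfolding finite_measurable_partition_def partition_on_def disjoint_def by blast
  then show "i' = i"
    using I i' assms(2) by (auto simp: bij_betw_def inj_on_def)
qed (use assms in auto)

lemma letter_in:
  assumes "x \<in> space M" shows "letter x j \<le> m" "(T ^^ j) x \<in> I (letter x j)"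
proof -
  have "(T ^^ j) x \<in> \<Union>Z"
    using Z funpow_space[OF assms] by (auto simp: finite_measurable_partition_def partition_on_def)
  then obtain i where "i \<le> m" "(T ^^ j) x \<in> I i"
    using I by (auto simp: bij_betw_def)
  moreover from this have "letter x j = i"
    using assms by (intro letter_eqI)
  ultimately show "letter x j \<le> m" "(T ^^ j) x \<in> I (letter x j)"
    by auto
qed

text \<open>As a function of a word, a cylinder visibly depends on \<open>x\<close> through finitely
  many letters only; measurability of the recurrence time rests on this.\<close>

definition word_cyl :: "nat \<Rightarrow> nat list \<Rightarrow> 'a set" where
  "word_cyl n w = {y \<in> space M. map (letter y) [0..<n] = w}"

lemma cyl_eq:
  assumes x: "x \<in> space M"
  shows "cyl M T Z n x = word_cyl n (map (letter x) [0..<n])"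
proof -
  let ?A = "word_cyl n (map (letter x) [0..<n])"
  have eq: "space M \<inter> (\<Inter>j<n. (T ^^ j) -` I (letter x j)) = ?A"
  proof -
    have "(T ^^ j) y \<in> I (letter x j) \<longleftrightarrow> letter y j = letter x j" if "y \<in> space M" for y j
      using letter_eqI[OF that letter_in(1)[OF x]] letter_in(2)[OF that] by metis
    then show ?thesis
      by (auto simp: word_cyl_def)
  qed
  show ?thesis
    unfolding cyl_def
  proof (rule the_equality)
    have "\<forall>j<n. I (letter x j) \<in> Z"
      using I letter_in(1)[OF x] by (auto simp: bij_betw_def)
    moreover have "x \<in> ?A"
      using x by (simp add: word_cyl_def)
    moreover have "?A = space M \<inter> (\<Inter>j<n. (T ^^ j) -` I (letter x j))"
      by (rule eq[symmetric])
    ultimately show "?A \<in> dyn_refinement M T Z n \<and> x \<in> ?A"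
      unfolding dyn_refinement_def by (intro conjI DiffI CollectI exI[of _ "\<lambda>j. I (letter x j)"]) auto
  next
    fix A assume "A \<in> dyn_refinement M T Z n \<and> x \<in> A"
    then obtain C where A: "A = space M \<inter> (\<Inter>j<n. (T ^^ j) -` C j)" "x \<in> A"
      and C: "\<forall>j<n. C j \<in> Z"
      by (auto simp: dyn_refinement_def)
    have "C j = I (letter x j)" if j: "j < n" for j
    proof -
      obtain i where "i \<le> m" "C j = I i"
        using C j I by (auto simp: bij_betw_def)
      moreover from this have "letter x j = i"
        using A j x by (intro letter_eqI) auto
      ultimately show ?thesis by simp
    qed
    then show "A = ?A"
      unfolding A(1) eq[symmetric] by auto
  qed
qed

abbreviation rec_time :: "nat \<Rightarrow> 'a \<Rightarrow> enat" where
  "rec_time n x \<equiv> recurrence_time T (cyl M T Z n x)"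

text \<open>\<open>T\<close> maps the cylinder of length \<open>Suc n\<close> at \<open>x\<close>
  into that of length \<open>n\<close> at \<open>T x\<close>, so returns are carried over with the
  same time.\<close>

lemma rec_time_shift:
  assumes x: "x \<in> space M"
  shows "rec_time n (T x) \<le> rec_time (Suc n) x"
proof (cases "rec_time (Suc n) x")
  case (enat j)
  have Tx: "T x \<in> space M"
    using funpow_space[OF x, of 1] by simp
  have sub: "T y \<in> cyl M T Z n (T x)" if y: "y \<in> cyl M T Z (Suc n) x" for y
    using y funpow_space[of y 1]
    by (auto simp: cyl_eq[OF x] cyl_eq[OF Tx] word_cyl_def symbol_funpow_Suc simp del: upt_Suc)
  from recurrence_time_attained[OF enat] obtain i y
    where i: "0 < i" "i \<le> j" and y: "y \<in> cyl M T Z (Suc n) x" "(T ^^ i) y \<in> cyl M T Z (Suc n) x"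
    by blast
  have "(T ^^ i) (T y) \<in> (T ^^ i) ` cyl M T Z n (T x) \<inter> cyl M T Z n (T x)"
    using sub[OF y(1)] sub[OF y(2)] by (simp add: funpow_swap1)
  then have "rec_time n (T x) \<le> enat i"
    using i by (intro recurrence_time_le) auto
  also have "\<dots> \<le> enat j" using i by simp
  finally show ?thesis using enat by simp
qed simp

text \<open>A returning point \<open>y\<close> reads the word of \<open>x\<close> both from time 0
  and from time \<open>i\<close>; comparing the two readings on their overlap gives the
  period.\<close>

lemma rec_time_period:
  assumes x: "x \<in> space M" and "rec_time n x = enat j"
  obtains i where "0 < i" "i \<le> j" "\<And>l. l + i < n \<Longrightarrow> letter x (l + i) = letter x l"
proof -
  obtain i y where i: "0 < i" "i \<le> j" and y: "y \<in> cyl M T Z n x" "(T ^^ i) y \<in> cyl M T Z n x"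
    using recurrence_time_attained[OF assms(2)] by blast
  have "letter x (l + i) = letter x l" if "l + i < n" for l
  proof -
    have "letter x (l + i) = letter y (l + i)"
      using y(1) that by (simp add: cyl_eq[OF x] word_cyl_def)
    also have "\<dots> = letter ((T ^^ i) y) l"
      by (simp add: symbol_def funpow_add)
    also have "\<dots> = letter x l"
      using y(2) that by (simp add: cyl_eq[OF x] word_cyl_def)
    finally show ?thesis .
  qed
  with i that show ?thesis by blast
qed

lemma measurable_word: "(\<lambda>x. map (letter x) [0..<n]) \<in> measurable M (count_space UNIV)"
proof (subst measurable_count_space_eq_countable; safe?)
  fix w
  have "{x \<in> space M. letter x j = i} \<in> sets M" for i j
  proof (cases "i \<le> m")
    case True
    then have "{x \<in> space M. letter x j = i} = (T ^^ j) -` I i \<inter> space M"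
      using letter_in letter_eqI by auto
    moreover have "I i \<in> sets M"
      using I Z True by (auto simp: finite_measurable_partition_def bij_betw_def)
    ultimately show ?thesis
      using measurable_sets[OF measurable_compose_n[OF T]] by simp
  next
    case False
    then have "{x \<in> space M. letter x j = i} = {}"
      using letter_in(1) by auto
    then show ?thesis by (metis sets.empty_sets)
  qed
  then have "{x \<in> space M. \<forall>j\<in>{..<n}. letter x j = w ! j} \<in> sets M"
    by (intro sets.sets_Collect_finite_All) auto
  moreover have "(\<lambda>x. map (letter x) [0..<n]) -` {w} \<inter> space M =
    (if length w = n then {x \<in> space M. \<forall>j\<in>{..<n}. letter x j = w ! j} else {})"
  proof (cases "length w = n")
    case True
    then have "map (letter x) [0..<n] = w \<longleftrightarrow> (\<forall>j\<in>{..<n}. letter x j = w ! j)" for x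
      by (simp add: list_eq_iff_nth_eq Ball_def)
    with True show ?thesis by auto
  qed auto
  ultimately show "(\<lambda>x. map (letter x) [0..<n]) -` {w} \<inter> space M \<in> sets M"
    by simp
qed auto

section \<open>Exponents with vanishing lower limit\<close>

definition recurrent :: "real \<Rightarrow> 'a \<Rightarrow> bool" where
  "recurrent \<alpha> x \<longleftrightarrow> liminf (\<lambda>n. ereal_of_enat (rec_time n x) / ereal (real n powr \<alpha>)) = 0"

lemma recurrent_iff: "recurrent \<alpha> x \<longleftrightarrow>
  (\<forall>e>0. \<exists>\<^sub>F n in sequentially. \<exists>j. rec_time n x = enat j \<and> real j < e * real n powr \<alpha>)"
  unfolding recurrent_def by (rule liminf_enat_quotient_eq_0_iff)

lemma recurrent_sets: "{x \<in> space M. recurrent \<alpha> x} \<in> sets M"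
proof -
  have "(\<lambda>x. ereal_of_enat (rec_time n x) / ereal (real n powr \<alpha>)) \<in> borel_measurable M" for n
  proof -
    \<comment> \<open>Words carry the discrete sigma-algebra, so any function of the word is
      measurable.\<close>
    have "(\<lambda>x. ereal_of_enat (recurrence_time T (word_cyl n (map (letter x) [0..<n]))) / ereal (real n powr \<alpha>))
      \<in> borel_measurable M"
      by (rule measurable_compose[OF measurable_word]) simp
    then show ?thesis
      by (rule measurable_cong[THEN iffD1, rotated]) (simp add: cyl_eq)
  qed
  then have "(\<lambda>x. liminf (\<lambda>n. ereal_of_enat (rec_time n x) / ereal (real n powr \<alpha>))) \<in> borel_measurable M"
    by (rule borel_measurable_liminf)
  then show ?thesis
    unfolding recurrent_def by measurable
qed

lemma recurrent_mono:
  assumes "recurrent \<alpha> x" "\<alpha> \<le> \<beta>" shows "recurrent \<beta> x"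
  unfolding recurrent_iff
proof safe
  fix e :: real assume "e > 0"
  with assms(1) have "\<exists>\<^sub>F n in sequentially. \<exists>j. rec_time n x = enat j \<and> real j < e * real n powr \<alpha>"
    unfolding recurrent_iff by blast
  then have "\<exists>\<^sub>F n in sequentially. 1 \<le> n \<and> (\<exists>j. rec_time n x = enat j \<and> real j < e * real n powr \<alpha>)"
    by (rule frequently_rev_mp) (use eventually_ge_at_top[of 1] in \<open>eventually_elim; simp\<close>)
  then show "\<exists>\<^sub>F n in sequentially. \<exists>j. rec_time n x = enat j \<and> real j < e * real n powr \<beta>"
  proof (rule frequently_elim1)
    fix n :: nat
    assume n: "1 \<le> n \<and> (\<exists>j. rec_time n x = enat j \<and> real j < e * real n powr \<alpha>)"
    have "e * real n powr \<alpha> \<le> e * real n powr \<beta>"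
      using n \<open>e > 0\<close> assms(2) by (intro mult_left_mono powr_mono) auto
    with n show "\<exists>j. rec_time n x = enat j \<and> real j < e * real n powr \<beta>"
      by force
  qed
qed

lemma recurrent_shift:
  assumes x: "x \<in> space M" and "recurrent \<alpha> x" shows "recurrent \<alpha> (T x)"
  unfolding recurrent_iff
proof safe
  fix e :: real assume e: "e > 0"
  \<comment> \<open>Replacing \<open>n = Suc n'\<close> by \<open>n'\<close> costs a factor of at
    most \<open>2 powr \<bar>\<alpha>\<bar>\<close>, as \<open>n \<le> 2 * n'\<close>; the absolute
    value covers negative \<open>\<alpha>\<close>.\<close>
  define e' where "e' = e / 2 powr \<bar>\<alpha>\<bar>"
  have "e' > 0" using e by (simp add: e'_def)
  show "\<exists>\<^sub>F n in sequentially. \<exists>j. rec_time n (T x) = enat j \<and> real j < e * real n powr \<alpha>"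
    unfolding frequently_sequentially
  proof
    fix N
    from \<open>e' > 0\<close> assms(2) obtain n j where n: "n \<ge> N + 2" "rec_time n x = enat j" "real j < e' * real n powr \<alpha>"
      unfolding recurrent_iff frequently_sequentially by blast
    then obtain n' where n': "n = Suc n'" "1 \<le> n'" "N \<le> n'"
      by (cases n) auto
    have "real n powr \<alpha> \<le> 2 powr \<bar>\<alpha>\<bar> * real n' powr \<alpha>"
    proof (cases "\<alpha> \<ge> 0")
      case True
      then have "real n powr \<alpha> \<le> (2 * real n') powr \<alpha>"
        using n' by (intro powr_mono2) auto
      with True show ?thesis by (simp add: powr_mult)
    next
      case False
      then have "real n powr \<alpha> \<le> real n' powr \<alpha>"
        using n' by (intro powr_mono2') auto
      also have "\<dots> \<le> 2 powr \<bar>\<alpha>\<bar> * real n' powr \<alpha>"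
        using ge_one_powr_ge_zero[of 2 "\<bar>\<alpha>\<bar>"] mult_right_mono[of 1 "2 powr \<bar>\<alpha>\<bar>" "real n' powr \<alpha>"] by simp
      finally show ?thesis .
    qed
    from mult_left_mono[OF this, of e'] \<open>e' > 0\<close> have "e' * real n powr \<alpha> \<le> e * real n' powr \<alpha>"
      by (simp add: e'_def)
    moreover obtain i where "rec_time n' (T x) = enat i" "i \<le> j"
      using rec_time_shift[OF x, of n'] n(2) n'(1) by (cases "rec_time n' (T x)") auto
    ultimately show "\<exists>n\<ge>N. \<exists>j. rec_time n (T x) = enat j \<and> real j < e * real n powr \<alpha>"
      using n n' by (intro exI[of _ n']) auto
  qed
qed

text \<open>For \<open>\<alpha> \<le> 0\<close> the power is at most 1, whereas a recurrence time is
  at least 1.\<close>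

lemma recurrent_pos:
  assumes "recurrent \<alpha> x" "x \<in> space M" shows "0 < \<alpha>"
proof (rule ccontr)
  assume \<alpha>: "\<not> 0 < \<alpha>"
  obtain n j where n: "n \<ge> 1" "rec_time n x = enat j" "real j < 1 * real n powr \<alpha>"
    using assms(1) unfolding recurrent_iff frequently_sequentially by (meson zero_less_one)
  have "real n powr \<alpha> \<le> real n powr 0"
    using \<alpha> n by (intro powr_mono) auto
  with n have "j = 0" by simp
  then show False
    using recurrence_time_attained[OF n(2)] by force
qed

lemma alpha_bar_eq: "alpha_bar M T Z x = Inf (ereal ` {\<alpha>. recurrent \<alpha> x})"
  unfolding alpha_bar_def recurrent_def by (rule arg_cong[where f = Inf]) auto

text \<open>By the zero-one law each exponent is recurrent almost everywhere or almost nowhere. One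
  null set serves all rational exponents, and the rational members of an upward closed set determine
  its infimum.\<close>

lemma alpha_bar_AE_const:
  assumes "ergodic M T" "conservative M T"
  shows "\<exists>a. AE x in M. alpha_bar M T Z x = a"
proof -
  define S where "S = {\<alpha>. AE x in M. recurrent \<alpha> x}"
  have *: "(AE x in M. recurrent \<alpha> x) \<or> (AE x in M. \<not> recurrent \<alpha> x)" for \<alpha>
  proof -
    have "{x \<in> space M. recurrent \<alpha> x} \<subseteq> T -` {x \<in> space M. recurrent \<alpha> x}"
    proof
      fix x assume "x \<in> {x \<in> space M. recurrent \<alpha> x}"
      then show "x \<in> T -` {x \<in> space M. recurrent \<alpha> x}"
        using recurrent_shift[of x \<alpha>] measurable_space[OF T, of x] by simp
    qed
    from zero_one[OF T assms recurrent_sets this] show ?thesis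
    proof
      assume "AE x in M. x \<in> {x \<in> space M. recurrent \<alpha> x}"
      then have "AE x in M. recurrent \<alpha> x"
        by eventually_elim simp
      then show ?thesis ..
    next
      assume "AE x in M. x \<notin> {x \<in> space M. recurrent \<alpha> x}"
      then have "AE x in M. \<not> recurrent \<alpha> x"
        using AE_space by eventually_elim auto
      then show ?thesis ..
    qed
  qed
  have "AE x in M. recurrent (real_of_rat q) x \<longleftrightarrow> real_of_rat q \<in> S" for q
  proof (cases "real_of_rat q \<in> S")
    case True
    then have "AE x in M. recurrent (real_of_rat q) x"
      by (simp add: S_def)
    then show ?thesis
      by eventually_elim (simp add: True)
  next
    case False
    then have "AE x in M. \<not> recurrent (real_of_rat q) x"
      using * by (auto simp: S_def)
    then show ?thesis
      by eventually_elim (simp add: False)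
  qed
  then have "AE x in M. \<forall>q. recurrent (real_of_rat q) x \<longleftrightarrow> real_of_rat q \<in> S"
    by (subst AE_all_countable) blast
  then have "AE x in M. alpha_bar M T Z x = Inf (ereal ` S)"
  proof eventually_elim
    case (elim x)
    have S_mono: "\<beta> \<in> S" if "\<alpha> \<in> S" "\<alpha> \<le> \<beta>" for \<alpha> \<beta>
      using that by (auto simp: S_def elim: eventually_mono recurrent_mono)
    \<comment> \<open>Density of the rationals; this serves both inequalities, with \<open>A\<close>
      either \<open>S\<close> or the exponents recurrent at \<open>x\<close>.\<close>
    have lim: "Inf (ereal ` A) \<le> ereal \<alpha>"
      if "\<And>q. \<alpha> < real_of_rat q \<Longrightarrow> real_of_rat q \<in> A" for A \<alpha>
    proof (rule dense_ge)
      fix y assume "ereal \<alpha> < y"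
      then obtain r where r: "\<alpha> < r" "ereal r < y"
        using ereal_dense2[of "ereal \<alpha>" y] by auto
      obtain q where "\<alpha> < real_of_rat q" "real_of_rat q < r"
        using of_rat_dense r by blast
      moreover from this have "ereal (real_of_rat q) \<le> y"
        using r(2) by (metis ereal_less_le less_eq_ereal_def less_imp_le order.trans ereal_less_eq(3))
      ultimately show "Inf (ereal ` A) \<le> y"
        using that by (intro INF_lower2[of "real_of_rat q"]) auto
    qed
    show ?case
      unfolding alpha_bar_eq
    proof (intro antisym INF_greatest lim)
      fix \<alpha> q assume "\<alpha> \<in> S" "\<alpha> < real_of_rat q"
      then show "real_of_rat q \<in> {\<alpha>. recurrent \<alpha> x}"
        using elim S_mono by auto
    next
      fix \<alpha> q assume "\<alpha> \<in> {\<alpha>. recurrent \<alpha> x}" "\<alpha> < real_of_rat q"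
      then show "real_of_rat q \<in> S"
        using elim recurrent_mono by auto
    qed
  qed
  then show ?thesis by blast
qed


end

section \<open>Constancy of the exponent and decay of the information content\<close>

theorem theorem5:
  fixes M :: "'a measure" and T :: "'a \<Rightarrow> 'a"
    and Z :: "'a set set" and I :: "nat \<Rightarrow> 'a set" and m :: nat
  assumes "invariant_measure M T" and "ergodic M T" and "conservative M T"
    and "finite_measurable_partition M Z" and "bij_betw I {..m} Z"
  shows "\<exists>a :: ereal.
    (AE x in M. alpha_bar M T Z x = a) \<and>
    (\<forall>A U. computable_enumeration A \<longrightarrow> universal_tm (Suc m) A U \<longrightarrow>
      (AE x in M. 0 \<le> upper_complexity U T I m x \<and> upper_complexity U T I m x < \<infinity>) \<longrightarrow>
      (AE x in M. \<forall>\<beta>::real. a < ereal \<beta> \<longrightarrow>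
        liminf (\<lambda>n. ereal_of_enat (orbit_AIC U T I m x n) / ereal (real n powr \<beta>)) = 0))"
proof -
  interpret coded_system M T Z I m
    by unfold_locales (use assms in \<open>auto simp: invariant_measure_def\<close>)
  obtain a where a: "AE x in M. alpha_bar M T Z x = a"
    using alpha_bar_AE_const assms(2,3) by blast
  show ?thesis
  proof (intro exI[of _ a] conjI allI impI a)
    fix A U
    assume A: "computable_enumeration A" and U: "universal_tm (Suc m) A U"
      and K: "AE x in M. 0 \<le> upper_complexity U T I m x \<and> upper_complexity U T I m x < \<infinity>"
    obtain P where "simulates (Suc m) P"
      using ex_simulates by blast
    then interpret moving_queue "Suc m" P
      by unfold_locales
    obtain D where D: "\<And>p s. tm_eval (Suc m) P p = Some s \<Longrightarrow> AIC (Suc m) U s \<le> enat (D + length p)"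
      using AIC_le[OF A U] by blast
    have AIC: "AIC (Suc m) U (concat (replicate (Suc N) (u # us))) \<le> enat (D + 3 * Suc m * length (u # us))"
      if u: "\<forall>u\<in>set (u # us). u < Suc m" "N < 2 ^ length us" for u us N
    proof -
      obtain p where "length p \<le> 3 * Suc m * length (u # us)"
        "tm_eval (Suc m) P p = Some (concat (replicate (Suc N) (u # us)))"
        using ex_program[OF u] by blast
      with D show ?thesis
        by (meson add_left_mono enat_ord_simps(1) order_trans)
    qed
    show "AE x in M. \<forall>\<beta>::real. a < ereal \<beta> \<longrightarrow>
      liminf (\<lambda>n. ereal_of_enat (orbit_AIC U T I m x n) / ereal (real n powr \<beta>)) = 0"
      using a K AE_space
    proof eventually_elim
      case (elim x)
      show ?case
      proof (intro allI impI)
        fix \<beta> :: real assume "a < ereal \<beta>"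
        \<comment> \<open>\<open>\<alpha>\<close> is chosen for the given \<open>x\<close> and
          \<open>\<beta>\<close>, so one null set serves all \<open>\<beta>\<close>.\<close>
        then obtain \<alpha> where \<alpha>: "recurrent \<alpha> x" "\<alpha> < \<beta>"
          using elim(1) by (auto simp: alpha_bar_eq INF_less_iff)
        have \<alpha>_pos: "0 < \<alpha>"
          using \<alpha>(1) elim(3) by (rule recurrent_pos)
        show "liminf (\<lambda>n. ereal_of_enat (orbit_AIC U T I m x n) / ereal (real n powr \<beta>)) = 0"
        proof (cases "\<alpha> < 1")
          case True
          have "\<exists>\<^sub>F n in sequentially. \<exists>j. rec_time n x = enat j \<and> real j < 1 * real n powr \<alpha>"
            using \<alpha>(1) zero_less_one unfolding recurrent_iff by blast
          then have "\<exists>\<^sub>F n in sequentially. \<exists>i>0. real i < real n powr \<alpha> \<and>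
            (\<forall>l. l + i < n \<longrightarrow> letter x (l + i) = letter x l)"
          proof (rule frequently_elim1)
            fix n assume "\<exists>j. rec_time n x = enat j \<and> real j < 1 * real n powr \<alpha>"
            then obtain j where j: "rec_time n x = enat j" "real j < real n powr \<alpha>"
              by auto
            obtain i where "0 < i" "i \<le> j" "\<And>l. l + i < n \<Longrightarrow> letter x (l + i) = letter x l"
              using rec_time_period[OF elim(3) j(1)] by blast
            with j(2) show "\<exists>i>0. real i < real n powr \<alpha> \<and>
              (\<forall>l. l + i < n \<longrightarrow> letter x (l + i) = letter x l)"
              by (intro exI[of _ i]) auto
          qed
          then show ?thesis
            unfolding orbit_AIC_def using letter_in(1)[OF elim(3)]
            by (intro liminf_periodic_words[OF AIC _ \<alpha>_pos \<alpha>(2) True]) (auto simp: less_Suc_eq_le)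
        next
          \<comment> \<open>Now \<open>\<beta> > \<alpha> \<ge> 1\<close>, and finiteness of the
            upper complexity takes over.\<close>
          case False
          then show ?thesis
            using elim(2) \<alpha>(2) unfolding upper_complexity_def
            by (intro liminf_quotient_powr_eq_0) auto
        qed
      qed
    qed
  qed
qed

end
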